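(* For every positive integer $n$, the Kirchhoff index of the prism graph $Y_n$ is $$Kf(Y_n)=\frac{n(n^2-1)}{6}+\frac{n^2}{\sqrt{3}}\left[\frac{2}{1-(2-\sqrt{3})^{n}}-1\right].$$
   Context: For $n\ge 3$, the prism graph $Y_n$ is the graph with $2n$ vertices $p_1,\dots,p_n,q_1,\dots,q_n$ and $3n$ edges: the cycle edges $p_jp_{j+1}$ and $q_jq_{j+1}$ (indices mod $n$) and the rungs $p_jq_j$; equivalently $Y_n=P_2\,\Box\, C_n$ (Cartesian product of the path on two vertices with the $n$-cycle). For $n=1,2$ the same Cartesian-product description is used with $C_2$ being two vertices joined by two parallel edges and $C_1$ being one vertex with a loop (so $Y_2$ is a 4-cycle $p_1p_2q_2q_1$ with the edges $p_1p_2$ and $q_1q_2$ doubled, and $Y_1$ is two vertices joined by one edge with a loop at each vertex). Every edge has resistance (length) $1$, and $Y_n$ is regarded as an electrical network; $r(p,q)$ denotes the effective resistance between vertices $p,q$. The Kirchhoff index is $Kf(G)=\frac12\sum_{p,q\in V(G)} r(p,q)$, i.e. the sum of effective resistances over unordered pairs of vertices. *)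

theory Defs
  imports "HOL-Analysis.Analysis" "Graph_Theory.Digraph"
begin

text \<open>
  An undirected multigraph, possibly with loops, is encoded as a \<^const>\<open>wf_digraph\<close> in which every
  undirected edge is represented by exactly \<^emph>\<open>one\<close> arc (and not by a pair of opposite arcs). The
  direction of the arc is arbitrary; it only fixes the sign of the current through the edge.
\<close>

definition path2 :: "(nat, unit) pre_digraph" where
  "path2 = \<lparr>verts = {0, 1}, arcs = {()}, tail = (\<lambda>_. 0), head = (\<lambda>_. 1)\<rparr>"

text \<open>
  Edge \<open>j\<close> joins \<open>j\<close> and \<open>j + 1\<close> modulo \<open>n\<close>. For \<open>n = 1\<close> this is a loop, and for
  \<open>n = 2\<close> it is a pair of parallel edges.
\<close>
definition cycle_graph :: "nat \<Rightarrow> (nat, nat) pre_digraph" where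
  "cycle_graph n =
     \<lparr>verts = {0..<n}, arcs = {0..<n}, tail = (\<lambda>j. j), head = (\<lambda>j. Suc j mod n)\<rparr>"

text \<open>
  In the Cartesian product, \<open>Inl (e, y)\<close> is the copy of the edge \<open>e\<close> of \<open>G\<close> in the layer of \<open>y\<close>,
  and \<open>Inr (x, f)\<close> is the copy of the edge \<open>f\<close> of \<open>H\<close> in the layer of \<open>x\<close>.
\<close>
definition box_product ::
  "('a, 'b) pre_digraph \<Rightarrow> ('c, 'd) pre_digraph \<Rightarrow> ('a \<times> 'c, 'b \<times> 'c + 'a \<times> 'd) pre_digraph" where
  "box_product G H =
     \<lparr>verts = verts G \<times> verts H,
      arcs = (arcs G \<times> verts H) <+> (verts G \<times> arcs H),
      tail = case_sum (\<lambda>(e, y). (tail G e, y)) (\<lambda>(x, f). (x, tail H f)),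
      head = case_sum (\<lambda>(e, y). (head G e, y)) (\<lambda>(x, f). (x, head H f))\<rparr>"

text \<open>The vertices \<open>(0, j)\<close> and \<open>(1, j)\<close> are $p_{j+1}$ and $q_{j+1}$.\<close>
definition prism_graph :: "nat \<Rightarrow> (nat \<times> nat, unit \<times> nat + nat \<times> nat) pre_digraph" where
  "prism_graph n = box_product path2 (cycle_graph n)"

text \<open>Ohm's law: the current through \<open>e\<close> from tail to head, at potentials \<open>v\<close> and resistances \<open>R\<close>.\<close>
definition arc_current ::
  "('a, 'b) pre_digraph \<Rightarrow> ('b \<Rightarrow> real) \<Rightarrow> ('a \<Rightarrow> real) \<Rightarrow> 'b \<Rightarrow> real" where
  "arc_current G R v e = (v (tail G e) - v (head G e)) / R e"

text \<open>Kirchhoff's current law, with a unit current injected at \<open>p\<close> and extracted at \<open>q\<close>.\<close>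
definition unit_current_potential ::
  "('a, 'b) pre_digraph \<Rightarrow> ('b \<Rightarrow> real) \<Rightarrow> 'a \<Rightarrow> 'a \<Rightarrow> ('a \<Rightarrow> real) \<Rightarrow> bool" where
  "unit_current_potential G R p q v \<longleftrightarrow>
     (\<forall>x\<in>verts G.
        (\<Sum>e | e \<in> arcs G \<and> tail G e = x. arc_current G R v e)
      - (\<Sum>e | e \<in> arcs G \<and> head G e = x. arc_current G R v e)
      = of_bool (x = p) - of_bool (x = q))"

text \<open>
  The potential difference between \<open>p\<close> and \<open>q\<close> under a unit current. In a finite connected network
  with positive resistances the potential exists and is unique up to an additive constant, so that
  the description is proper there.
\<close>
definition effective_resistance ::
  "('a, 'b) pre_digraph \<Rightarrow> ('b \<Rightarrow> real) \<Rightarrow> 'a \<Rightarrow> 'a \<Rightarrow> real" where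
  "effective_resistance G R p q =
     (THE r. \<exists>v. unit_current_potential G R p q v \<and> r = v p - v q)"

definition kirchhoff_index :: "('a, 'b) pre_digraph \<Rightarrow> ('b \<Rightarrow> real) \<Rightarrow> real" where
  "kirchhoff_index G R = (1/2) * (\<Sum>p\<in>verts G. \<Sum>q\<in>verts G. effective_resistance G R p q)"

end

theory Submission
  imports Defs
begin

text \<open>
  Green's functions \<open>\<phi>\<^sub>p\<close> whose net current is \<open>\<delta>\<^sub>p\<close> minus a constant give
  \<open>r(p, q) = \<phi>\<^sub>p(p) - \<phi>\<^sub>p(q) - \<phi>\<^sub>q(p) + \<phi>\<^sub>q(q)\<close>. On the prism, splitting a potential into the parts
  that are even and odd under exchange of the two layers turns the Laplacian into the Laplacian \<open>C\<close>
  of the cycle and \<open>C + 2\<close>. Green's function of \<open>C\<close> is quadratic in the distance \<open>k\<close>; that of \<open>C + 2\<close>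
  is a multiple of \<open>x\<^sup>k + x\<^sup>n\<^sup>-\<^sup>k\<close>, where \<open>x = 2 - \<surd>3\<close> is a root of \<open>x + 1/x = 4\<close>. In the Kirchhoff index
  the odd part contributes only through its diagonal.
\<close>

section \<open>Green's identity and effective resistance in finite networks\<close>

definition net_current ::
  "('a, 'b) pre_digraph \<Rightarrow> ('b \<Rightarrow> real) \<Rightarrow> ('a \<Rightarrow> real) \<Rightarrow> 'a \<Rightarrow> real" where
  "net_current G R v x =
     (\<Sum>e | e \<in> arcs G \<and> tail G e = x. arc_current G R v e)
   - (\<Sum>e | e \<in> arcs G \<and> head G e = x. arc_current G R v e)"

lemma unit_current_potential_iff:
  "unit_current_potential G R p q v \<longleftrightarrow>
     (\<forall>x\<in>verts G. net_current G R v x = of_bool (x = p) - of_bool (x = q))"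
  by (simp add: unit_current_potential_def net_current_def)

lemma net_current_diff:
  "net_current G R (\<lambda>x. v x - w x) x = net_current G R v x - net_current G R w x"
proof -
  have "arc_current G R (\<lambda>x. v x - w x) e = arc_current G R v e - arc_current G R w e" for e
    by (simp add: arc_current_def diff_divide_distrib)
  then show ?thesis
    by (simp add: net_current_def sum_subtractf)
qed

text \<open>Summation by parts: each arc contributes its current with weight \<open>w\<close> at its
  tail and with opposite sign at its head. The resulting form is symmetric in \<open>v\<close> and
  \<open>w\<close>.\<close>

lemma (in fin_digraph) sum_net_current:
  "(\<Sum>x\<in>verts G. net_current G R v x * w x) =
     (\<Sum>e\<in>arcs G. (v (tail G e) - v (head G e)) * (w (tail G e) - w (head G e)) / R e)"
proof -
  have *: "(\<Sum>x\<in>verts G. (\<Sum>e | e \<in> arcs G \<and> f e = x. arc_current G R v e) * w x) =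
      (\<Sum>e\<in>arcs G. arc_current G R v e * w (f e))"
    if "f ` arcs G \<subseteq> verts G" for f
  proof -
    have "(\<Sum>x\<in>verts G. (\<Sum>e | e \<in> arcs G \<and> f e = x. arc_current G R v e) * w x) =
        (\<Sum>x\<in>verts G. \<Sum>e | e \<in> arcs G \<and> f e = x. arc_current G R v e * w (f e))"
      by (simp add: sum_distrib_right)
    also have "\<dots> = (\<Sum>e\<in>arcs G. arc_current G R v e * w (f e))"
      using that by (intro sum.group) auto
    finally show ?thesis .
  qed
  have "(\<Sum>x\<in>verts G. net_current G R v x * w x) =
      (\<Sum>e\<in>arcs G. arc_current G R v e * w (tail G e)) -
      (\<Sum>e\<in>arcs G. arc_current G R v e * w (head G e))"
    unfolding net_current_def left_diff_distrib sum_subtractf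
    by (subst (1 2) *) auto
  then show ?thesis
    by (simp add: arc_current_def sum_subtractf[symmetric] right_diff_distrib
      diff_divide_distrib[symmetric])
qed

text \<open>
  Well-definedness needs no connectedness: by Green's identity, the potential difference under
  \<open>v\<close> equals the one under any other solution \<open>w\<close>.
\<close>
lemma (in fin_digraph) effective_resistance_eqI:
  assumes "p \<in> verts G" "q \<in> verts G" "unit_current_potential G R p q v"
  shows "effective_resistance G R p q = v p - v q"
proof -
  have eq: "(\<Sum>x\<in>verts G. net_current G R u x * w x) = w p - w q"
    if "unit_current_potential G R p q u" for u w
  proof -
    have "(\<Sum>x\<in>verts G. net_current G R u x * w x) =
        (\<Sum>x\<in>verts G. (if x = p then w x else 0) - (if x = q then w x else 0))"
      using that by (intro sum.cong) (auto simp: unit_current_potential_iff)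
    also have "\<dots> = w p - w q"
      using assms(1,2) by (simp add: sum_subtractf)
    finally show ?thesis .
  qed
  have "w p - w q = v p - v q" if "unit_current_potential G R p q w" for w
  proof -
    have "w p - w q = (\<Sum>x\<in>verts G. net_current G R v x * w x)"
      using eq[OF assms(3)] by simp
    also have "\<dots> = (\<Sum>x\<in>verts G. net_current G R w x * v x)"
      unfolding sum_net_current by (simp add: mult.commute)
    finally show ?thesis
      using eq[OF that] by simp
  qed
  then show ?thesis
    unfolding effective_resistance_def using assms(3) by (intro the_equality) blast+
qed

text \<open>The constant \<open>c\<close> cancels in \<open>\<phi> p - \<phi> q\<close>, which is
  thus a unit current potential. In the double sum of its potential differences the two diagonal
  terms agree, and so do the two mixed ones after swapping the sums; this absorbs the factor
  1/2.\<close>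

lemma (in fin_digraph) kirchhoff_index_green:
  assumes green: "\<And>p x. p \<in> verts G \<Longrightarrow> x \<in> verts G \<Longrightarrow>
    net_current G R (\<phi> p) x = of_bool (x = p) - c"
  shows "kirchhoff_index G R =
    real (card (verts G)) * (\<Sum>p\<in>verts G. \<phi> p p) - (\<Sum>p\<in>verts G. \<Sum>q\<in>verts G. \<phi> p q)"
proof -
  have "effective_resistance G R p q = (\<phi> p p - \<phi> q p) - (\<phi> p q - \<phi> q q)"
    if "p \<in> verts G" "q \<in> verts G" for p q
    using that
    by (intro effective_resistance_eqI[where v = "\<lambda>x. \<phi> p x - \<phi> q x"])
      (auto simp: unit_current_potential_iff net_current_diff green)
  then have "kirchhoff_index G R =
      1/2 * (\<Sum>p\<in>verts G. \<Sum>q\<in>verts G. (\<phi> p p - \<phi> q p) - (\<phi> p q - \<phi> q q))"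
    by (simp add: kirchhoff_index_def)
  moreover have "(\<Sum>p\<in>verts G. \<Sum>q\<in>verts G. \<phi> q p) = (\<Sum>p\<in>verts G. \<Sum>q\<in>verts G. \<phi> p q)"
    by (rule sum.swap)
  ultimately show ?thesis
    by (simp add: sum_subtractf sum_distrib_left[symmetric])
qed

section \<open>Net currents in the prism\<close>

lemma prism_graph_simps:
  "verts (prism_graph n) = {0, 1} \<times> {0..<n}"
  "arcs (prism_graph n) = ({()} \<times> {0..<n}) <+> ({0, 1} \<times> {0..<n})"
  "tail (prism_graph n) (Inl (u, j)) = (0, j)"
  "head (prism_graph n) (Inl (u, j)) = (1, j)"
  "tail (prism_graph n) (Inr (i, j)) = (i, j)"
  "head (prism_graph n) (Inr (i, j)) = (i, Suc j mod n)"
  by (simp_all add: prism_graph_def box_product_def path2_def cycle_graph_def)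

lemma fin_digraph_prism_graph: "fin_digraph (prism_graph n)"
  by standard (auto simp: prism_graph_simps)

lemma Suc_mod_eq_iff:
  assumes "j < n" "e < n"
  shows "Suc e mod n = j \<longleftrightarrow> e = (j + n - 1) mod n"
proof -
  have "Suc e mod n = (if Suc e = n then 0 else Suc e)"
    using assms by auto
  moreover have "(j + n - 1) mod n = (if j = 0 then n - 1 else j - 1)"
  proof (cases j)
    case (Suc i)
    then have "(j + n - 1) mod n = (i + n) mod n" by simp
    then show ?thesis using Suc assms by simp
  qed (use assms in simp)
  ultimately show ?thesis
    using assms by auto
qed

text \<open>Loops and parallel edges fit the same formula: for \<open>n = 1\<close> both cycle
  neighbours are the vertex itself and cancel \<open>2 * v (i, j)\<close>; for \<open>n = 2\<close>
  they coincide and count twice.\<close>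

lemma net_current_prism_graph:
  assumes "i \<in> {0, 1}" "j < n"
  shows "net_current (prism_graph n) (\<lambda>_. 1) v (i, j) =
    v (i, j) - v (1 - i, j)
      + 2 * v (i, j) - v (i, Suc j mod n) - v (i, (j + n - 1) mod n)"
proof -
  let ?G = "prism_graph n"
  define k where "k = (j + n - 1) mod n"
  have k: "k < n"
    using assms by (simp add: k_def)
  have pred: "Suc e mod n = j \<longleftrightarrow> e = k" if "e < n" for e
    using Suc_mod_eq_iff[OF assms(2) that] by (simp add: k_def)
  \<comment> \<open>Rungs point from layer 0 to layer 1, so the rung leaves in one layer and enters
    in the other.\<close>
  have t: "{e. e \<in> arcs ?G \<and> tail ?G e = (i, j)} =
      (if i = 0 then {Inl ((), j), Inr (0, j)} else {Inr (i, j)})"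
    using assms by (auto simp: prism_graph_simps split: if_splits)
  have h: "{e. e \<in> arcs ?G \<and> head ?G e = (i, j)} =
      (if i = 1 then {Inl ((), j), Inr (1, k)} else {Inr (i, k)})"
    using assms k by (auto simp: prism_graph_simps pred split: if_splits)
  show ?thesis
    unfolding net_current_def t h k_def[symmetric]
    using assms(1) k pred[OF k] by (auto simp: arc_current_def prism_graph_simps)
qed

section \<open>Translations of the cycle\<close>

definition cycle_laplacian :: "nat \<Rightarrow> (nat \<Rightarrow> real) \<Rightarrow> nat \<Rightarrow> real" where
  "cycle_laplacian n u j = 2 * u j - u (Suc j mod n) - u ((j + n - 1) mod n)"

text \<open>Moves the source \<open>b\<close> to offset 0. The condition \<open>f n = f 0\<close>
  absorbs the wrap-around at \<open>Suc k = n\<close>, so only the predecessor needs a case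
  distinction.\<close>

lemma cycle_laplacian_translate:
  assumes "b < n" "j < n" "f n = f 0"
  defines "k \<equiv> (j + (n - b)) mod n"
  shows "cycle_laplacian n (\<lambda>j. f ((j + (n - b)) mod n)) j =
    2 * f k - f (Suc k) - f (if k = 0 then n - 1 else k - 1)"
proof -
  have kn: "k < n" using assms by simp
  have "(Suc j mod n + (n - b)) mod n = Suc k mod n"
    unfolding k_def by (simp add: mod_simps)
  then have s: "f ((Suc j mod n + (n - b)) mod n) = f (Suc k)"
    using kn assms(3) by (cases "Suc k = n") auto
  have "((j + n - 1) mod n + (n - b)) mod n = (j + (n - 1) + (n - b)) mod n"
    using assms by (simp only: mod_add_left_eq) simp
  also have "\<dots> = (j + (n - b) + (n - 1)) mod n"
    by (simp only: add_ac)
  also have "\<dots> = (k + n - 1) mod n"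
    using assms(1) mod_add_left_eq[of "j + (n - b)" n "n - 1"] by (simp add: k_def)
  also have "\<dots> = (if k = 0 then n - 1 else k - 1)"
  proof (cases k)
    case (Suc i)
    then have "(k + n - 1) mod n = (i + n) mod n" by simp
    then show ?thesis using Suc kn by simp
  qed (use kn in simp)
  finally have p: "((j + n - 1) mod n + (n - b)) mod n = (if k = 0 then n - 1 else k - 1)" .
  show ?thesis
    unfolding cycle_laplacian_def s p k_def ..
qed

lemma offset_eq_0_iff:
  fixes b j n :: nat
  assumes "b < n" "j < n"
  shows "(j + (n - b)) mod n = 0 \<longleftrightarrow> j = b"
proof (cases "b \<le> j")
  case True
  then have eq: "j + (n - b) = j - b + n"
    using assms by arith
  have "(j + (n - b)) mod n = j - b"
    unfolding eq using assms by simp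
  then show ?thesis
    using True by simp
next
  case False
  then have "(j + (n - b)) mod n = j + (n - b)"
    using assms by (intro mod_less) arith
  then show ?thesis
    using assms False by (simp only:) arith
qed

lemma sum_translate:
  assumes "b < (n :: nat)"
  shows "(\<Sum>j = 0..<n. f ((j + (n - b)) mod n)) = (\<Sum>k = 0..<n. f k)"
proof (rule sum.reindex_bij_witness[where i = "\<lambda>k. (k + b) mod n" and j = "\<lambda>j. (j + (n - b)) mod n"])
  fix j assume "j \<in> {0..<n}"
  have "((j + (n - b)) mod n + b) mod n = (j + (n - b) + b) mod n"
    by (simp add: mod_simps)
  also have "\<dots> = (j + n) mod n"
    using assms by simp
  finally show "((j + (n - b)) mod n + b) mod n = j"
    using \<open>j \<in> {0..<n}\<close> by simp
next
  fix k assume "k \<in> {0..<n}"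
  have "((k + b) mod n + (n - b)) mod n = (k + b + (n - b)) mod n"
    by (simp add: mod_simps)
  also have "\<dots> = (k + n) mod n"
    using assms by simp
  finally show "((k + b) mod n + (n - b)) mod n = k"
    using \<open>k \<in> {0..<n}\<close> by simp
qed (use assms in auto)

section \<open>Green's functions of the two cycle operators\<close>

definition even_green :: "nat \<Rightarrow> nat \<Rightarrow> real" where
  "even_green n k = - real k * (real n - real k) / (2 * real n)"

text \<open>With \<open>x = 2 - sqrt 3\<close>, this is the periodisation over multiples of
  \<open>n\<close> of \<open>x ^ \<bar>k\<bar> / (2 * sqrt 3)\<close>, the decaying Green's function
  on the infinite path.\<close>

definition odd_green :: "nat \<Rightarrow> nat \<Rightarrow> real" where
  "odd_green n k =
    ((2 - sqrt 3) ^ k + (2 - sqrt 3) ^ (n - k)) / (2 * sqrt 3 * (1 - (2 - sqrt 3) ^ n))"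

text \<open>The quadratic has constant second difference, giving \<open>- 1 / n\<close> off the
  source; at offset 0 both neighbours have the value \<open>- (n - 1) / (2 * n)\<close>, giving
  \<open>1 - 1 / n\<close>.\<close>

lemma cycle_laplacian_even_green:
  assumes "b < n" "j < n"
  shows "cycle_laplacian n (\<lambda>j. even_green n ((j + (n - b)) mod n)) j = of_bool (j = b) - 1 / real n"
proof -
  define k where "k = (j + (n - b)) mod n"
  have n: "real n > 0" using assms by simp
  have "2 * even_green n k - even_green n (Suc k) - even_green n (if k = 0 then n - 1 else k - 1) =
      of_bool (k = 0) - 1 / real n"
  proof (cases k)
    case 0
    then show ?thesis
      using n assms by (simp add: even_green_def of_nat_diff field_simps)
  next
    case (Suc i)
    then show ?thesis
      using n by (simp add: even_green_def field_simps)
  qed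
  moreover have "cycle_laplacian n (\<lambda>j. even_green n ((j + (n - b)) mod n)) j =
      2 * even_green n k - even_green n (Suc k) - even_green n (if k = 0 then n - 1 else k - 1)"
    unfolding k_def using assms by (intro cycle_laplacian_translate) (simp_all add: even_green_def)
  moreover have "k = 0 \<longleftrightarrow> j = b"
    unfolding k_def by (rule offset_eq_0_iff[OF assms])
  ultimately show ?thesis
    unfolding k_def[symmetric] by simp
qed

lemma two_minus_sqrt3: "0 < 2 - sqrt 3" "2 - sqrt 3 < 1"
proof -
  have "sqrt 3 < 2"
    by (rule real_less_lsqrt) auto
  moreover have "1 < sqrt (3 :: real)"
    by simp
  ultimately show "0 < 2 - sqrt 3" "2 - sqrt 3 < 1"
    by linarith+
qed

lemma cycle_laplacian_odd_green:
  assumes "b < n" "j < n"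
  shows "cycle_laplacian n (\<lambda>j. odd_green n ((j + (n - b)) mod n)) j
    + 2 * odd_green n ((j + (n - b)) mod n) = of_bool (j = b)"
proof -
  define k where "k = (j + (n - b)) mod n"
  define x where "x = 2 - sqrt (3 :: real)"
  define d where "d = 2 * sqrt 3 * (1 - x ^ n)"
  have x: "x * x = 4 * x - 1"
    by (simp add: x_def algebra_simps)
  have xx: "x * (x * y) = 4 * (x * y) - y" for y
  proof -
    have "x * (x * y) = (4 * x - 1) * y"
      by (simp only: mult.assoc[symmetric] x)
    then show ?thesis
      by (simp add: left_diff_distrib)
  qed
  have "x ^ n < 1"
    using two_minus_sqrt3 assms by (simp add: x_def power_less_one_iff)
  then have d: "d \<noteq> 0"
    by (simp add: d_def)
  have h: "odd_green n m = (x ^ m + x ^ (n - m)) / d" for m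
    by (simp add: odd_green_def x_def d_def)
  have kn: "k < n" using assms by (simp add: k_def)
  have "4 * odd_green n k - odd_green n (Suc k) - odd_green n (if k = 0 then n - 1 else k - 1) =
      of_bool (k = 0)"
  proof (cases k)
    case 0
    obtain m where m: "n = Suc m"
      using kn by (cases n) auto
    \<comment> \<open>The strength of the source fixes the normalisation \<open>d\<close>, since
      \<open>4 - 2 * x = 2 * sqrt 3\<close>.\<close>
    have "4 * (1 + x ^ n) - (x + x ^ m) - (x ^ m + x) = (4 - 2 * x) * (1 - x ^ n)"
      by (simp add: m xx algebra_simps)
    also have "\<dots> = d"
      by (simp add: d_def x_def)
    finally have "(4 * (1 + x ^ n) - (x + x ^ m) - (x ^ m + x)) / d = 1"
      using d by simp
    moreover have "odd_green n 0 = (1 + x ^ n) / d" "odd_green n (Suc 0) = (x + x ^ m) / d"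
      "odd_green n m = (x ^ m + x) / d"
      unfolding h by (simp_all add: m)
    ultimately show ?thesis
      using 0 by (simp only: diff_divide_distrib) (simp add: m add_divide_distrib)
  next
    case (Suc i)
    obtain m where m: "n = Suc (Suc i) + m"
      using kn Suc less_iff_Suc_add by auto
    \<comment> \<open>Off the source, the rising and the falling powers each satisfy the recurrence
      with characteristic equation \<open>x * x = 4 * x - 1\<close>.\<close>
    have "4 * (x ^ Suc i + x ^ Suc m) - (x ^ Suc (Suc i) + x ^ m) - (x ^ i + x ^ Suc (Suc m)) = 0"
      by (simp add: xx)
    then have "(4 * (x ^ Suc i + x ^ Suc m) - (x ^ Suc (Suc i) + x ^ m) - (x ^ i + x ^ Suc (Suc m))) / d = 0"
      by simp
    moreover have "odd_green n (Suc i) = (x ^ Suc i + x ^ Suc m) / d"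
      "odd_green n (Suc (Suc i)) = (x ^ Suc (Suc i) + x ^ m) / d"
      "odd_green n i = (x ^ i + x ^ Suc (Suc m)) / d"
      unfolding h by (simp_all add: m)
    ultimately show ?thesis
      using Suc by (simp only: diff_divide_distrib) simp
  qed
  moreover have "cycle_laplacian n (\<lambda>j. odd_green n ((j + (n - b)) mod n)) j =
      2 * odd_green n k - odd_green n (Suc k) - odd_green n (if k = 0 then n - 1 else k - 1)"
    unfolding k_def using assms by (intro cycle_laplacian_translate) (simp_all add: odd_green_def)
  moreover have "k = 0 \<longleftrightarrow> j = b"
    unfolding k_def by (rule offset_eq_0_iff[OF assms])
  ultimately show ?thesis
    unfolding k_def[symmetric] by simp
qed

section \<open>Green's function of the prism and its sums\<close>

definition prism_green :: "nat \<Rightarrow> nat \<times> nat \<Rightarrow> nat \<times> nat \<Rightarrow> real" where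
  "prism_green n p q =
    (even_green n ((snd q + (n - snd p)) mod n)
      + (if fst q = fst p then 1 else -1) * odd_green n ((snd q + (n - snd p)) mod n)) / 2"

text \<open>The rung term annihilates the even part and doubles the odd part, whence the extra 2 in
  the odd operator.\<close>

lemma net_current_prism_green:
  assumes "p \<in> verts (prism_graph n)" "q \<in> verts (prism_graph n)"
  shows "net_current (prism_graph n) (\<lambda>_. 1) (prism_green n p) q =
    of_bool (q = p) - 1 / (2 * real n)"
proof -
  obtain a b i j where pq: "p = (a, b)" "q = (i, j)"
    by (cases p, cases q)
  have *: "a \<in> {0, 1}" "i \<in> {0, 1}" "b < n" "j < n"
    using assms by (auto simp: pq prism_graph_simps)
  define s :: real where "s = (if i = a then 1 else -1)"
  let ?g = "\<lambda>j. even_green n ((j + (n - b)) mod n)"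
  let ?h = "\<lambda>j. odd_green n ((j + (n - b)) mod n)"
  have 1: "prism_green n p (i, l) = (?g l + s * ?h l) / 2" for l
    by (simp add: prism_green_def pq s_def)
  have 2: "prism_green n p (1 - i, l) = (?g l - s * ?h l) / 2" for l
  proof -
    have flip: "1 - i = a \<longleftrightarrow> i \<noteq> a"
      using *(1,2) by auto
    show ?thesis
      unfolding prism_green_def pq fst_conv snd_conv s_def flip
      by (cases "i = a") simp_all
  qed
  have split: "(g + s * h) / 2 - (g - s * h) / 2 + 2 * ((g + s * h) / 2)
      - (g\<^sub>1 + s * h\<^sub>1) / 2 - (g\<^sub>2 + s * h\<^sub>2) / 2 =
      (2 * g - g\<^sub>1 - g\<^sub>2 + s * (2 * h - h\<^sub>1 - h\<^sub>2 + 2 * h)) / 2" for g g\<^sub>1 g\<^sub>2 h h\<^sub>1 h\<^sub>2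
    by (simp add: field_simps)
  have "net_current (prism_graph n) (\<lambda>_. 1) (prism_green n p) q =
      (cycle_laplacian n ?g j + s * (cycle_laplacian n ?h j + 2 * ?h j)) / 2"
    unfolding pq(2) net_current_prism_graph[OF *(2,4)] 1 2 cycle_laplacian_def
    by (rule split)
  also have "\<dots> = (of_bool (j = b) - 1 / real n + s * of_bool (j = b)) / 2"
    using * by (simp only: cycle_laplacian_even_green cycle_laplacian_odd_green)
  \<comment> \<open>The two point sources add up in the layer of \<open>p\<close> and cancel in the
    other.\<close>
  also have "\<dots> = of_bool (q = p) - 1 / (2 * real n)"
    by (auto simp: pq s_def field_simps)
  finally show ?thesis .
qed

lemma sum_even_green:
  assumes "n \<ge> 1"
  shows "(\<Sum>k = 0..<n. even_green n k) = - ((real n)\<^sup>2 - 1) / 12"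
proof -
  \<comment> \<open>The upper limit \<open>m\<close> is decoupled from \<open>c\<close> so that the
    induction goes through.\<close>
  have "(\<Sum>k = 0..<m. real k * (c - real k)) =
      c * (real m * (real m - 1) / 2) - real m * (real m - 1) * (2 * real m - 1) / 6" for m c
    by (induction m) (simp_all add: field_simps)
  from this[of "real n" n] have "(\<Sum>k = 0..<n. real k * (real n - real k)) =
      real n * ((real n)\<^sup>2 - 1) / 6"
    by (simp add: field_simps power2_eq_square)
  moreover have "(\<Sum>k = 0..<n. even_green n k) =
      - (\<Sum>k = 0..<n. real k * (real n - real k)) / (2 * real n)"
    by (simp add: even_green_def sum_negf sum_divide_distrib)
  ultimately show ?thesis
    using assms by (simp only:) (simp add: field_simps)
qed

theorem theorem3p1:
  fixes n :: nat
  assumes "n \<ge> 1"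
  shows "kirchhoff_index (prism_graph n) (\<lambda>_. 1) =
    real n * ((real n)\<^sup>2 - 1) / 6
      + (real n)\<^sup>2 / sqrt 3 * (2 / (1 - (2 - sqrt 3) ^ n) - 1)"
proof -
  interpret fin_digraph "prism_graph n"
    by (rule fin_digraph_prism_graph)
  let ?V = "verts (prism_graph n)"
  have V: "(\<Sum>p\<in>?V. F p) = (\<Sum>b = 0..<n. F (0, b) + F (1, b))" for F :: "nat \<times> nat \<Rightarrow> real"
    by (simp add: prism_graph_simps sum.cartesian_product' sum.distrib)
  have card: "card ?V = 2 * n"
    by (simp add: prism_graph_simps card_cartesian_product)
  \<comment> \<open>The even part vanishes at offset 0.\<close>
  have diag: "(\<Sum>p\<in>?V. prism_green n p p) = real n * odd_green n 0"
    by (simp add: V prism_green_def even_green_def)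
  \<comment> \<open>Here the odd parts of the two layers cancel.\<close>
  have "(\<Sum>q\<in>?V. prism_green n p q) = - ((real n)\<^sup>2 - 1) / 12" if "p \<in> ?V" for p
  proof -
    have "(\<Sum>q\<in>?V. prism_green n p q) =
        (\<Sum>j = 0..<n. even_green n ((j + (n - snd p)) mod n))"
      using that unfolding V
      by (intro sum.cong) (auto simp: prism_green_def prism_graph_simps field_simps)
    also have "\<dots> = (\<Sum>k = 0..<n. even_green n k)"
      using that by (intro sum_translate) (auto simp: prism_graph_simps)
    finally show ?thesis
      using assms by (simp add: sum_even_green)
  qed
  then have "(\<Sum>p\<in>?V. \<Sum>q\<in>?V. prism_green n p q) = (\<Sum>p\<in>?V. - ((real n)\<^sup>2 - 1) / 12)"
    by (intro sum.cong refl)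
  then have off: "(\<Sum>p\<in>?V. \<Sum>q\<in>?V. prism_green n p q) = 2 * real n * (- ((real n)\<^sup>2 - 1) / 12)"
    by (simp add: card)
  have "(2 - sqrt 3) ^ n < (1 :: real)"
    using two_minus_sqrt3 assms by (simp add: power_less_one_iff)
  \<comment> \<open>Uses \<open>(1 + y) / (1 - y) = 2 / (1 - y) - 1\<close> for
    \<open>y = (2 - sqrt 3) ^ n\<close>.\<close>
  then have odd0: "odd_green n 0 = (2 / (1 - (2 - sqrt 3) ^ n) - 1) / (2 * sqrt 3)"
    by (simp add: odd_green_def field_simps)
  have "kirchhoff_index (prism_graph n) (\<lambda>_. 1) =
      real (2 * n) * (real n * odd_green n 0) - 2 * real n * (- ((real n)\<^sup>2 - 1) / 12)"
    using kirchhoff_index_green[OF net_current_prism_green] by (simp add: card diag off)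
  moreover have "2 * N * (N * (y / (2 * sqrt 3))) - 2 * N * (- (N\<^sup>2 - 1) / 12) =
      N * (N\<^sup>2 - 1) / 6 + N\<^sup>2 / sqrt 3 * y" for N y :: real
    by (simp add: field_simps power2_eq_square)
  ultimately show ?thesis
    unfolding odd0
    by (simp only: of_nat_mult of_nat_numeral)
qed

end
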